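(* Let $r$ be a complex number and $n\ge0$ an integer. For every real $\alpha\geq 0$, $$\beta_{n}(\alpha,r-\alpha)=\sum_{k=0}^{n}S_{2}(n,k,r\mid\alpha)\frac{(-1)^{k}\langle\alpha+1\rangle_{k}}{k+1}.$$
   Context: All generating functions are formal power series in $t$; $(1+\alpha t)^{c/\alpha}=\exp\left(\frac{c}{\alpha}\log(1+\alpha t)\right)$, interpreted as $e^{ct}$ when $\alpha=0$. Carlitz's degenerate Bernoulli polynomials $\beta_n(\alpha,x)$ are defined by $$\sum_{n=0}^{\infty}\beta_{n}(\alpha,x)\frac{t^{n}}{n!}=\frac{t}{(1+\alpha t)^{1/\alpha}-1}(1+\alpha t)^{x/\alpha}.$$ Howard's degenerate weighted Stirling numbers of the second kind $S_2(n,k,r\mid\alpha)$ are defined by $$\left((1+\alpha t)^{1/\alpha}-1\right)^{k}(1+\alpha t)^{r/\alpha}=k!\sum_{n=0}^{\infty}S_{2}(n,k,r\mid\alpha)\frac{t^{n}}{n!}.$$ The rising factorial is $\langle y\rangle_{0}=1$, $\langle y\rangle_{k}=y(y+1)\cdots(y+k-1)$. *)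

theory Defs
  imports "HOL-Computational_Algebra.Computational_Algebra"
begin

text \<open>
  \<open>deg_exp \<alpha> c\<close> is the formal power series $(1+\alpha t)^{c/\alpha}$, i.e.
  $\exp((c/\alpha)\log(1+\alpha t))$ for $\alpha \neq 0$ and $e^{ct}$ for $\alpha = 0$.
  Note that \<open>fps_ln 1\<close> is the series of $\log(1+t)$.
\<close>

definition deg_exp :: "complex \<Rightarrow> complex \<Rightarrow> complex fps" where
  "deg_exp \<alpha> c =
     (if \<alpha> = 0 then fps_exp c
      else fps_exp 1 oo (fps_const (c / \<alpha>) * (fps_ln 1 oo (fps_const \<alpha> * fps_X))))"

text \<open>
  The divisor \<open>deg_exp \<alpha> 1 - 1\<close> has zero constant term and linear coefficient 1. Division of
  power series over a field cancels the common factor \<open>fps_X\<close>, so the quotient below is exact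
  (see \<open>deg_bernoulli_quotient\<close>).
\<close>

definition deg_bernoulli :: "nat \<Rightarrow> complex \<Rightarrow> complex \<Rightarrow> complex" where
  "deg_bernoulli n \<alpha> x =
     fact n * fps_nth (fps_X / (deg_exp \<alpha> 1 - 1) * deg_exp \<alpha> x) n"

definition deg_wstirling2 :: "nat \<Rightarrow> nat \<Rightarrow> complex \<Rightarrow> complex \<Rightarrow> complex" where
  "deg_wstirling2 n k r \<alpha> =
     fact n / fact k * fps_nth ((deg_exp \<alpha> 1 - 1) ^ k * deg_exp \<alpha> r) n"

lemma deg_exp_nth_0: "fps_nth (deg_exp \<alpha> c) 0 = 1"
  by (simp add: deg_exp_def fps_compose_nth)

lemma deg_exp_nth_1: "fps_nth (deg_exp \<alpha> c) 1 = c"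
  by (simp add: deg_exp_def fps_compose_nth fps_mult_nth fps_ln_def)

lemma deg_bernoulli_quotient:
  "fps_X / (deg_exp \<alpha> 1 - 1) * (deg_exp \<alpha> 1 - 1) = fps_X"
proof -
  have nz: "fps_nth (deg_exp \<alpha> 1 - 1) 1 \<noteq> 0"
    using deg_exp_nth_1[of \<alpha> 1] by simp
  hence "deg_exp \<alpha> 1 - 1 \<noteq> 0" by (metis fps_zero_nth)
  moreover have "subdegree (deg_exp \<alpha> 1 - 1) \<le> 1"
    using nz by (rule subdegree_leI)
  ultimately have "(deg_exp \<alpha> 1 - 1) dvd fps_X"
    by (simp add: fps_dvd_iff)
  thus ?thesis by (rule dvd_div_mult_self)
qed

lemma deg_bernoulli_gf:
  "Abs_fps (\<lambda>n. deg_bernoulli n \<alpha> x / fact n) =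
     fps_X / (deg_exp \<alpha> 1 - 1) * deg_exp \<alpha> x"
  by (rule fps_ext) (simp add: deg_bernoulli_def)

lemma deg_wstirling2_gf:
  "fps_const (fact k) * Abs_fps (\<lambda>n. deg_wstirling2 n k r \<alpha> / fact n) =
     (deg_exp \<alpha> 1 - 1) ^ k * deg_exp \<alpha> r"
  by (rule fps_ext) (simp add: deg_wstirling2_def)

end

theory Submission
  imports Defs
begin

text \<open>
  Write $E_c = (1+\alpha t)^{c/\alpha}$ and $u = E_1 - 1$. The series $E_c$ is the unique solution of
  $(1+\alpha t)\,y' = c\,y$ with $y(0) = 1$, which yields $E_{a+b} = E_a E_b$ and
  $(1+u)^c = E_c$ for all $\alpha$, including $\alpha = 0$. If $h$ has the coefficients
  $(-1)^k\langle\alpha+1\rangle_k / ((k+1)\,k!)$, then $(t\,h(t))' = (1+t)^{-\alpha-1}$. Hence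
  $u\,h(u)$ and $t\,E_{-\alpha}$ both have derivative $E_{-\alpha}/(1+\alpha t)$, so they agree,
  and $h(u)\,E_r = (t/u)\,E_{r-\alpha}$. The theorem compares coefficients in this identity.
\<close>

text \<open>Comparing coefficients of t^n gives (n+1) w_{n+1} = (c - a n) w_n. Since n+1 is nonzero
  in the complex numbers, the constant term determines the whole series.\<close>

lemma fps_linear_ode_unique:
  fixes y z :: "complex fps"
  assumes y: "(1 + fps_const a * fps_X) * fps_deriv y = fps_const c * y"
    and z: "(1 + fps_const a * fps_X) * fps_deriv z = fps_const c * z"
    and init: "fps_nth y 0 = fps_nth z 0"
  shows "y = z"
proof (rule fps_ext)
  have rec: "of_nat (Suc n) * fps_nth w (Suc n) = (c - a * of_nat n) * fps_nth w n"
    if "(1 + fps_const a * fps_X) * fps_deriv w = fps_const c * w" for w :: "complex fps" and n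
  proof -
    have "fps_nth ((1 + fps_const a * fps_X) * fps_deriv w) n = fps_nth (fps_const c * w) n"
      using that by simp
    then show ?thesis
      by (cases n) (simp_all add: distrib_right mult.assoc algebra_simps)
  qed
  show "fps_nth y n = fps_nth z n" for n
  proof (induction n)
    case 0
    show ?case by (rule init)
  next
    case (Suc n)
    have "of_nat (Suc n) * fps_nth y (Suc n) = (of_nat (Suc n) * fps_nth z (Suc n) :: complex)"
      unfolding rec[OF y] rec[OF z] Suc.IH ..
    then show ?case by (simp del: of_nat_Suc)
  qed
qed

text \<open>For nonzero \<open>a\<close> this is the chain rule with l = log(1+at), where (1+at) l'
  = a. The equation covers \<open>a = 0\<close> as well, so later arguments need no case
  split.\<close>

lemma deg_exp_ode:
  "(1 + fps_const a * fps_X) * fps_deriv (deg_exp a c) = fps_const c * deg_exp a c"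
proof (cases "a = 0")
  case True
  then show ?thesis by (simp add: deg_exp_def)
next
  case False
  define l :: "complex fps" where "l = fps_ln 1 oo (fps_const a * fps_X)"
  \<comment> \<open>Substituting at into (1+t) log(1+t)' = 1 will give the equation for l'.\<close>
  have "fps_deriv (fps_ln (1::complex)) * (1 + fps_X) = 1"
    by (simp add: fps_ln_deriv inverse_mult_eq_1)
  then have "(fps_deriv (fps_ln (1::complex)) * (1 + fps_X)) oo (fps_const a * fps_X) = 1"
    by simp
  then have "(fps_deriv (fps_ln 1) oo (fps_const a * fps_X)) * (1 + fps_const a * fps_X) = 1"
    by (simp add: fps_compose_mult_distrib fps_compose_add_distrib)
  then have l: "(1 + fps_const a * fps_X) * fps_deriv l = fps_const a"
    by (simp add: l_def fps_compose_deriv) (metis mult.commute mult.left_commute mult_1_right)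
  have l0: "fps_nth (fps_const (c / a) * l) 0 = 0"
    by (simp add: l_def fps_ln_def)
  have E: "deg_exp a c = fps_exp 1 oo (fps_const (c / a) * l)"
    using False by (simp add: deg_exp_def l_def)
  have "(1 + fps_const a * fps_X) * fps_deriv (deg_exp a c) =
      deg_exp a c * fps_const (c / a) * ((1 + fps_const a * fps_X) * fps_deriv l)"
    using l0 by (simp add: E fps_compose_deriv algebra_simps)
  also have "\<dots> = fps_const c * deg_exp a c"
    unfolding l using False by (simp add: mult.assoc mult.commute)
  finally show ?thesis .
qed

text \<open>By the Leibniz rule the product solves the equation with constant b+c, and its constant
  term is 1.\<close>

lemma deg_exp_add: "deg_exp a (b + c) = deg_exp a b * deg_exp a c"
proof (rule fps_linear_ode_unique)
  show "(1 + fps_const a * fps_X) * fps_deriv (deg_exp a (b + c)) =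
      fps_const (b + c) * deg_exp a (b + c)"
    by (rule deg_exp_ode)
  have "(1 + fps_const a * fps_X) * fps_deriv (deg_exp a b * deg_exp a c) =
      deg_exp a b * ((1 + fps_const a * fps_X) * fps_deriv (deg_exp a c)) +
      ((1 + fps_const a * fps_X) * fps_deriv (deg_exp a b)) * deg_exp a c"
    by (simp add: algebra_simps)
  also have "\<dots> = (fps_const b + fps_const c) * (deg_exp a b * deg_exp a c)"
    unfolding deg_exp_ode by (simp only: algebra_simps)
  finally show "(1 + fps_const a * fps_X) * fps_deriv (deg_exp a b * deg_exp a c) =
      fps_const (b + c) * (deg_exp a b * deg_exp a c)"
    by simp
qed (simp add: deg_exp_nth_0)

lemma deriv_deg_exp_1:
  "(1 + fps_const a * fps_X) * fps_deriv (deg_exp a 1 - 1) = deg_exp a 1"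
  using deg_exp_ode[of a 1] by simp

text \<open>Substituting u into (1+t) B' = c B turns 1+t into E_1, which is exactly the factor
  (1+at) u' that the chain rule produces.\<close>

lemma fps_binomial_compose_deg_exp:
  "fps_binomial c oo (deg_exp a 1 - 1) = deg_exp a c"
proof (rule fps_linear_ode_unique)
  let ?u = "deg_exp a 1 - 1"
  have u0: "fps_nth ?u 0 = 0" by (simp add: deg_exp_nth_0)
  have "fps_deriv (fps_binomial c) * (1 + fps_X) = fps_const c * fps_binomial c"
    by (simp add: fps_binomial_deriv fps_divide_unit mult.assoc inverse_mult_eq_1)
  then have "(fps_deriv (fps_binomial c) * (1 + fps_X)) oo ?u = (fps_const c * fps_binomial c) oo ?u"
    by simp
  then have B: "(fps_deriv (fps_binomial c) oo ?u) * deg_exp a 1 =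
      fps_const c * (fps_binomial c oo ?u)"
    using u0 by (simp add: fps_compose_mult_distrib fps_compose_add_distrib)
  have "(1 + fps_const a * fps_X) * fps_deriv (fps_binomial c oo ?u) =
      (fps_deriv (fps_binomial c) oo ?u) * ((1 + fps_const a * fps_X) * fps_deriv ?u)"
    unfolding fps_compose_deriv[OF u0] by (simp only: mult_ac)
  then show "(1 + fps_const a * fps_X) * fps_deriv (fps_binomial c oo ?u) =
      fps_const c * (fps_binomial c oo ?u)"
    unfolding deriv_deg_exp_1 B .
qed (simp_all add: deg_exp_ode deg_exp_nth_0)

lemma deg_exp_primitive:
  fixes H :: "complex fps"
  assumes H: "fps_deriv (fps_X * H) = fps_binomial (- a - 1)"
  shows "(deg_exp a 1 - 1) * (H oo (deg_exp a 1 - 1)) = fps_X * deg_exp a (- a)"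
proof -
  let ?u = "deg_exp a 1 - 1" and ?D = "1 + fps_const a * fps_X"
  have u0: "fps_nth ?u 0 = 0" by (simp add: deg_exp_nth_0)
  have nz: "?D \<noteq> 0"
  proof
    assume "?D = 0"
    then have "fps_nth ?D 0 = 0" by simp
    then show False by simp
  qed
  have comp: "?u * (H oo ?u) = (fps_X * H) oo ?u"
    using u0 by (simp add: fps_compose_mult_distrib)
  have "?D * fps_deriv ((fps_X * H) oo ?u) = (fps_binomial (- a - 1) oo ?u) * (?D * fps_deriv ?u)"
    unfolding fps_compose_deriv[OF u0] H by (simp only: mult_ac)
  also have "\<dots> = deg_exp a (- a - 1) * deg_exp a 1"
    unfolding fps_binomial_compose_deg_exp deriv_deg_exp_1 ..
  also have "\<dots> = deg_exp a (- a)"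
    by (simp flip: deg_exp_add)
  \<comment> \<open>Adding and subtracting at E_{-a} makes the ODE applicable to the last term; what
    results is \<open>?D\<close> times a Leibniz derivative.\<close>
  also have "\<dots> = ?D * deg_exp a (- a) + fps_X * (fps_const (- a) * deg_exp a (- a))"
    by (simp add: algebra_simps flip: fps_const_neg)
  also have "\<dots> = ?D * fps_deriv (fps_X * deg_exp a (- a))"
    unfolding deg_exp_ode[symmetric] by (simp add: algebra_simps)
  finally have "fps_deriv ((fps_X * H) oo ?u) = fps_deriv (fps_X * deg_exp a (- a))"
    using nz by simp
  \<comment> \<open>Both series have constant term 0, so equal derivatives suffice.\<close>
  then have "(fps_X * H) oo ?u = fps_X * deg_exp a (- a)"
    unfolding fps_deriv_eq_iff by simp
  then show ?thesis by (simp add: comp)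
qed

text \<open>Separates the coefficients of \<open>H\<close> from those of u^k E, which for E = E_r
  are the Stirling numbers up to the factor k!/n!.\<close>

lemma fps_compose_mult_nth:
  fixes H u E :: "complex fps"
  assumes u0: "fps_nth u 0 = 0"
  shows "fps_nth ((H oo u) * E) n = (\<Sum>k=0..n. fps_nth H k * fps_nth (u ^ k * E) n)"
proof -
  \<comment> \<open>The power u^k has no terms below t^k, so the sum over k \<le> i may run to n, a
    bound independent of i that lets the sums be swapped.\<close>
  have "fps_nth (H oo u) i = (\<Sum>k=0..n. fps_nth H k * fps_nth (u ^ k) i)" if "i \<le> n" for i
    unfolding fps_compose_nth
    using that u0 by (intro sum.mono_neutral_left) (auto simp: startsby_zero_power_prefix)
  then have "fps_nth ((H oo u) * E) n =
      (\<Sum>i=0..n. \<Sum>k=0..n. fps_nth H k * (fps_nth (u ^ k) i * fps_nth E (n - i)))"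
    by (simp add: fps_mult_nth sum_distrib_right mult.assoc)
  also have "\<dots> = (\<Sum>k=0..n. fps_nth H k * fps_nth (u ^ k * E) n)"
    by (subst sum.swap) (simp add: fps_mult_nth sum_distrib_left)
  finally show ?thesis .
qed

theorem corollary6:
  fixes r :: complex and n :: nat and \<alpha> :: real
  assumes "\<alpha> \<ge> 0"
  shows "deg_bernoulli n (complex_of_real \<alpha>) (r - complex_of_real \<alpha>) =
    (\<Sum>k=0..n. deg_wstirling2 n k r (complex_of_real \<alpha>) *
       ((-1) ^ k * pochhammer (complex_of_real \<alpha> + 1) k) / of_nat (k + 1))"
proof -
  define a where "a = complex_of_real \<alpha>"
  define u where "u = deg_exp a 1 - 1"
  \<comment> \<open>The factor k+1 in the denominator cancels on differentiating t H(t); k! matches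
    the normalization of the Stirling numbers.\<close>
  define H :: "complex fps" where
    "H = Abs_fps (\<lambda>k. (-1) ^ k * pochhammer (a + 1) k / (of_nat (k + 1) * fact k))"
  have u0: "fps_nth u 0 = 0" by (simp add: u_def deg_exp_nth_0)
  have "fps_nth u 1 = 1" using deg_exp_nth_1[of a 1] by (simp add: u_def)
  then have nz: "u \<noteq> 0" by auto
  have "fps_deriv (fps_X * H) = fps_binomial (- a - 1)"
  proof (rule fps_ext)
    fix k
    have "fps_nth (fps_deriv (fps_X * H)) k = of_nat (k + 1) * fps_nth H k"
      by (simp add: algebra_simps)
    also have "\<dots> = (-1) ^ k * pochhammer (a + 1) k / fact k"
      by (simp add: H_def del: of_nat_Suc)
    \<comment> \<open>Negating the upper index turns the binomial coefficient of -a-1 over k into a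
      signed rising factorial of a+1.\<close>
    also have "\<dots> = fps_nth (fps_binomial (- a - 1)) k"
      by (simp add: gbinomial_pochhammer add.commute)
    finally show "fps_nth (fps_deriv (fps_X * H)) k = fps_nth (fps_binomial (- a - 1)) k" .
  qed
  then have prim: "u * (H oo u) = fps_X * deg_exp a (- a)"
    unfolding u_def by (rule deg_exp_primitive)
  have "u * ((H oo u) * deg_exp a r) = fps_X * deg_exp a (r - a)"
    using deg_exp_add[of a "- a" r] by (simp add: prim flip: mult.assoc)
  also have "\<dots> = u * (fps_X / u * deg_exp a (r - a))"
    using deg_bernoulli_quotient[of a, folded u_def] by (metis mult.assoc mult.commute)
  finally have gf: "fps_X / u * deg_exp a (r - a) = (H oo u) * deg_exp a r"
    using nz by simp
  have "deg_bernoulli n a (r - a) =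
      (\<Sum>k=0..n. fact n * (fps_nth H k * fps_nth (u ^ k * deg_exp a r) n))"
    unfolding deg_bernoulli_def u_def[symmetric] gf fps_compose_mult_nth[OF u0]
    by (rule sum_distrib_left)
  also have "\<dots> = (\<Sum>k=0..n. deg_wstirling2 n k r a *
       ((-1) ^ k * pochhammer (a + 1) k) / of_nat (k + 1))"
    by (simp add: deg_wstirling2_def H_def u_def mult_ac)
  finally show ?thesis unfolding a_def .
qed

end
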